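(* Let $\theta \in \mathrm{ADT}_1$ be an attack-defense tree of countermeasure-depth at most $1$. Then $[\![\theta]\!] \neq \emptyset$ if and only if there is a trace $t \in [\![\theta]\!]$ with $|t| \le |\theta|$.
   Context: Fix a finite set $\mathrm{Prop}$ of propositions (with $\top := p\lor\neg p$ for $p\in\mathrm{Prop}$, and $\bot:=\neg\top$) and let $\Sigma = 2^{\mathrm{Prop}}$ be the alphabet of valuations. A trace is a word $t\in\Sigma^*$; $|t|$ is its length; $\varepsilon$ is the empty trace. The set $\mathrm{ADT}$ of attack-defense trees is defined inductively: the special leaf $\epsilon$ and every propositional formula $\gamma$ over $\mathrm{Prop}$ are in $\mathrm{ADT}$; if $\theta_1,\dots,\theta_n\in\mathrm{ADT}$ then $\mathrm{OR}(\theta_1,\dots,\theta_n)$, $\mathrm{SAND}(\theta_1,\dots,\theta_n)$, $\mathrm{AND}(\theta_1,\dots,\theta_n)\in\mathrm{ADT}$; if $\theta,\theta'\in\mathrm{ADT}$ then $\mathrm{C}(\theta,\theta')\in\mathrm{ADT}$. The size $|\theta|$ is the sum of the sizes of the leaves of $\theta$, where the leaf $\epsilon$ has size $1$ and a leaf $\gamma$ has its size as a propositional formula. Semantics $[\![\theta]\!]\subseteq\Sigma^*$: $[\![\epsilon]\!]=\{\varepsilon\}$; $[\![\gamma]\!]=\{v_1\cdots v_n\in\Sigma^* : n\ge 1,\ v_n\models\gamma\}$; $\mathrm{OR}$ is interpreted as union, $\mathrm{SAND}$ as concatenation (in the given order), $[\![\mathrm{C}(\theta_1,\theta_2)]\!]=[\![\theta_1]\!]\setminus[\![\theta_2]\!]$,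 and $[\![\mathrm{AND}(\theta_1,\dots,\theta_n)]\!]=\bigcup_{i}\big([\![\theta_i]\!]\cap\bigcap_{j\ne i}[\![\theta_j]\!]\cdot\Sigma^*\big)$. Countermeasure-depth: $\mathrm{cd}(\epsilon)=\mathrm{cd}(\gamma)=0$; $\mathrm{cd}(\mathrm{OP}(\theta_1,\dots,\theta_n))=\max_i\mathrm{cd}(\theta_i)$ for $\mathrm{OP}\in\{\mathrm{OR},\mathrm{SAND},\mathrm{AND}\}$; $\mathrm{cd}(\mathrm{C}(\theta_1,\theta_2))=\max\{\mathrm{cd}(\theta_1),\mathrm{cd}(\theta_2)+1\}$. $\mathrm{ADT}_k=\{\theta\in\mathrm{ADT}:\mathrm{cd}(\theta)\le k\}$. *)

theory Defs
  imports Main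
begin

text \<open>
  The finite nonempty set of propositions is the universe of a type \<open>'p\<close> of class
  \<open>finite\<close>; a valuation is the set of propositions that it makes true.
\<close>

datatype 'p form =
    Atom 'p
  | Neg "'p form"
  | Conj "'p form" "'p form"
  | Disj "'p form" "'p form"

primrec models :: "'p set \<Rightarrow> 'p form \<Rightarrow> bool" (infix "\<Turnstile>" 50) where
  "v \<Turnstile> Atom p \<longleftrightarrow> p \<in> v"
| "v \<Turnstile> Neg \<gamma> \<longleftrightarrow> \<not> v \<Turnstile> \<gamma>"
| "v \<Turnstile> Conj \<gamma> \<delta> \<longleftrightarrow> v \<Turnstile> \<gamma> \<and> v \<Turnstile> \<delta>"
| "v \<Turnstile> Disj \<gamma> \<delta> \<longleftrightarrow> v \<Turnstile> \<gamma> \<or> v \<Turnstile> \<delta>"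

text \<open>
  The number of occurrences of propositions and connectives. (The automatically generated
  function \<open>size\<close> does not count atoms.)
\<close>

primrec form_size :: "'p form \<Rightarrow> nat" where
  "form_size (Atom p) = 1"
| "form_size (Neg \<gamma>) = form_size \<gamma> + 1"
| "form_size (Conj \<gamma> \<delta>) = form_size \<gamma> + form_size \<delta> + 1"
| "form_size (Disj \<gamma> \<delta>) = form_size \<gamma> + form_size \<delta> + 1"

type_synonym 'p trace = "'p set list"

definition conc :: "'a list set \<Rightarrow> 'a list set \<Rightarrow> 'a list set" (infixr "\<cdot>" 75) where
  "A \<cdot> B = {u @ v | u v. u \<in> A \<and> v \<in> B}"

text \<open>
  The datatype also contains terms in which an operator has no arguments; the set \<open>ADT\<close>
  below excludes them.
\<close>

datatype 'p adt =
    Eps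
  | Leaf "'p form"
  | OR "'p adt list"
  | SAND "'p adt list"
  | AND "'p adt list"
  | Counter "'p adt" "'p adt"

inductive_set ADT :: "'p adt set" where
  Eps: "Eps \<in> ADT"
| Leaf: "Leaf \<gamma> \<in> ADT"
| OR: "\<lbrakk>\<theta>s \<noteq> []; \<forall>\<theta> \<in> set \<theta>s. \<theta> \<in> ADT\<rbrakk> \<Longrightarrow> OR \<theta>s \<in> ADT"
| SAND: "\<lbrakk>\<theta>s \<noteq> []; \<forall>\<theta> \<in> set \<theta>s. \<theta> \<in> ADT\<rbrakk> \<Longrightarrow> SAND \<theta>s \<in> ADT"
| AND: "\<lbrakk>\<theta>s \<noteq> []; \<forall>\<theta> \<in> set \<theta>s. \<theta> \<in> ADT\<rbrakk> \<Longrightarrow> AND \<theta>s \<in> ADT"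
| Counter: "\<lbrakk>\<theta> \<in> ADT; \<theta>' \<in> ADT\<rbrakk> \<Longrightarrow> Counter \<theta> \<theta>' \<in> ADT"

primrec adt_size :: "'p adt \<Rightarrow> nat" where
  "adt_size Eps = 1"
| "adt_size (Leaf \<gamma>) = form_size \<gamma>"
| "adt_size (OR \<theta>s) = sum_list (map adt_size \<theta>s)"
| "adt_size (SAND \<theta>s) = sum_list (map adt_size \<theta>s)"
| "adt_size (AND \<theta>s) = sum_list (map adt_size \<theta>s)"
| "adt_size (Counter \<theta> \<theta>') = adt_size \<theta> + adt_size \<theta>'"

definition and_lang :: "'a list set list \<Rightarrow> 'a list set" where
  "and_lang Ls =
    (\<Union>i < length Ls. Ls ! i \<inter> (\<Inter>j \<in> {..<length Ls} - {i}. Ls ! j \<cdot> UNIV))"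

primrec sem :: "'p adt \<Rightarrow> 'p trace set" ("\<lbrakk>_\<rbrakk>\<^sub>t") where
  "\<lbrakk>Eps\<rbrakk>\<^sub>t = {[]}"
| "\<lbrakk>Leaf \<gamma>\<rbrakk>\<^sub>t = {t. t \<noteq> [] \<and> last t \<Turnstile> \<gamma>}"
| "\<lbrakk>OR \<theta>s\<rbrakk>\<^sub>t = \<Union> (set (map sem \<theta>s))"
| "\<lbrakk>SAND \<theta>s\<rbrakk>\<^sub>t = foldr (\<cdot>) (map sem \<theta>s) {[]}"
| "\<lbrakk>AND \<theta>s\<rbrakk>\<^sub>t = and_lang (map sem \<theta>s)"
| "\<lbrakk>Counter \<theta> \<theta>'\<rbrakk>\<^sub>t = \<lbrakk>\<theta>\<rbrakk>\<^sub>t - \<lbrakk>\<theta>'\<rbrakk>\<^sub>t"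

primrec cd :: "'p adt \<Rightarrow> nat" where
  "cd Eps = 0"
| "cd (Leaf \<gamma>) = 0"
| "cd (OR \<theta>s) = Max (set (map cd \<theta>s))"
| "cd (SAND \<theta>s) = Max (set (map cd \<theta>s))"
| "cd (AND \<theta>s) = Max (set (map cd \<theta>s))"
| "cd (Counter \<theta> \<theta>') = max (cd \<theta>) (cd \<theta>' + 1)"

definition ADT_level :: "nat \<Rightarrow> 'p adt set" where
  "ADT_level k = {\<theta> \<in> ADT. cd \<theta> \<le> k}"

end

theory Submission
  imports Defs
begin

text \<open>
  A trace of a tree of countermeasure-depth at most \<open>1\<close> has a set of at most \<open>|\<theta>|\<close> marked
  positions, among them its last one, such that erasing any unmarked letters stays in the
  semantics. A countermeasure has depth \<open>0\<close>, so its language is closed under inserting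
  letters anywhere but at the end; hence erasing letters other than the last one never
  makes the countermeasure succeed. Erasing all unmarked letters gives the short trace.
\<close>

section \<open>Languages closed under inserting letters before the last one\<close>

definition insertion_closed :: "'a list set \<Rightarrow> bool" where
  "insertion_closed L \<longleftrightarrow> (\<forall>u a v. u @ v \<in> L \<longrightarrow> v \<noteq> [] \<longrightarrow> u @ a # v \<in> L)"

lemma insertion_closedI:
  "(\<And>u a v. \<lbrakk>u @ v \<in> L; v \<noteq> []\<rbrakk> \<Longrightarrow> u @ a # v \<in> L) \<Longrightarrow> insertion_closed L"
  by (simp add: insertion_closed_def)

lemma insertion_closedD:
  "\<lbrakk>insertion_closed L; u @ v \<in> L; v \<noteq> []\<rbrakk> \<Longrightarrow> u @ a # v \<in> L"
  by (simp add: insertion_closed_def)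

lemma insertion_closed_conc:
  assumes A: "insertion_closed A" and B: "insertion_closed B"
  shows "insertion_closed (A \<cdot> B)"
proof (rule insertion_closedI)
  fix u a v
  assume "u @ v \<in> A \<cdot> B" and v: "v \<noteq> []"
  then obtain x y where xy: "u @ v = x @ y" "x \<in> A" "y \<in> B"
    by (auto simp: conc_def)
  \<comment> \<open>The insertion point at the border of \<open>x\<close> and \<open>y\<close> is
    assigned to \<open>y\<close>, because a letter may not be appended at the end of
    \<open>x\<close>.\<close>
  from xy(1) consider (left) w where "x = u @ w" "v = w @ y" "w \<noteq> []"
    | (right) w where "u = x @ w" "y = w @ v"
    unfolding append_eq_append_conv2 by (metis append_Nil append_Nil2)
  then show "u @ a # v \<in> A \<cdot> B"
  proof cases
    case left
    with insertion_closedD[OF A, of u w a] xy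
    have "u @ a # w \<in> A" by simp
    moreover have "u @ a # v = (u @ a # w) @ y" using left by simp
    ultimately show ?thesis using xy(3) unfolding conc_def by blast
  next
    case right
    with insertion_closedD[OF B, of w v a] xy v
    have "w @ a # v \<in> B" by simp
    moreover have "u @ a # v = x @ (w @ a # v)" using right by simp
    ultimately show ?thesis using xy(2) unfolding conc_def by blast
  qed
qed

lemma insertion_closed_foldr_conc:
  assumes "\<And>L. L \<in> set Ls \<Longrightarrow> insertion_closed L"
  shows "insertion_closed (foldr (\<cdot>) Ls {[]})"
  using assms
proof (induction Ls)
  case Nil
  then show ?case by (simp add: insertion_closed_def)
next
  case (Cons L Ls)
  then show ?case by (simp add: insertion_closed_conc)
qed

lemma insertion_closed_and_lang:
  assumes "\<And>L. L \<in> set Ls \<Longrightarrow> insertion_closed L"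
  shows "insertion_closed (and_lang Ls)"
proof (rule insertion_closedI)
  fix u a v
  assume "u @ v \<in> and_lang Ls" and v: "v \<noteq> []"
  then obtain i where i: "i < length Ls" "u @ v \<in> Ls ! i"
    and rest: "\<And>j. j < length Ls \<Longrightarrow> j \<noteq> i \<Longrightarrow> u @ v \<in> Ls ! j \<cdot> UNIV"
    by (auto simp: and_lang_def)
  \<comment> \<open>This makes each language \<open>Ls ! j \<cdot> UNIV\<close> of extensions
    closed, as a concatenation of closed languages.\<close>
  have UNIV: "insertion_closed UNIV"
    by (simp add: insertion_closed_def)
  have "u @ a # v \<in> Ls ! i"
    using i v assms insertion_closedD by (metis nth_mem)
  moreover have "u @ a # v \<in> Ls ! j \<cdot> UNIV" if "j < length Ls" "j \<noteq> i" for j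
    using rest[OF that] insertion_closed_conc[OF assms UNIV] v that insertion_closedD
    by (metis nth_mem)
  ultimately show "u @ a # v \<in> and_lang Ls"
    using i(1) unfolding and_lang_def by blast
qed

lemma cd_le_Max: "\<theta> \<in> set \<theta>s \<Longrightarrow> Max (set (map cd \<theta>s)) \<le> k \<Longrightarrow> cd \<theta> \<le> k"
  by (rule order_trans[OF Max_ge]) auto

text \<open>A leaf formula constrains only the last letter, which an insertion never changes; union,
  concatenation and \<open>and_lang\<close> preserve closure, and depth 0 rules out
  \<open>Counter\<close>.\<close>

lemma insertion_closed_sem: "cd \<theta> = 0 \<Longrightarrow> insertion_closed \<lbrakk>\<theta>\<rbrakk>\<^sub>t"
proof (induction \<theta>)
  case Eps
  then show ?case by (simp add: insertion_closed_def)
next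
  case (Leaf \<gamma>)
  then show ?case by (auto simp: insertion_closed_def)
next
  case (OR \<theta>s)
  then have "\<And>\<theta>. \<theta> \<in> set \<theta>s \<Longrightarrow> insertion_closed \<lbrakk>\<theta>\<rbrakk>\<^sub>t"
    using cd_le_Max[of _ \<theta>s 0] by simp
  then show ?case unfolding insertion_closed_def by fastforce
next
  case (SAND \<theta>s)
  then have "\<And>\<theta>. \<theta> \<in> set \<theta>s \<Longrightarrow> insertion_closed \<lbrakk>\<theta>\<rbrakk>\<^sub>t"
    using cd_le_Max[of _ \<theta>s 0] by simp
  then show ?case using insertion_closed_foldr_conc[of "map sem \<theta>s"] by auto
next
  case (AND \<theta>s)
  then have "\<And>\<theta>. \<theta> \<in> set \<theta>s \<Longrightarrow> insertion_closed \<lbrakk>\<theta>\<rbrakk>\<^sub>t"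
    using cd_le_Max[of _ \<theta>s 0] by simp
  then show ?case using insertion_closed_and_lang[of "map sem \<theta>s"] by auto
next
  case (Counter \<theta> \<theta>')
  then show ?case by simp
qed

section \<open>Erasing letters and marking positions\<close>

lemma insertion_closed_nths:
  assumes "insertion_closed L" and "p @ nths t S \<in> L" and "t \<noteq> [] \<Longrightarrow> length t - 1 \<in> S"
  shows "p @ t \<in> L"
  using assms(2,3)
\<comment> \<open>The erased letters are put back one at a time. The prefix \<open>p\<close> is
  general so that a first letter that is kept can be moved into it.\<close>
proof (induction t arbitrary: p S)
  case Nil
  then show ?case by simp
next
  case (Cons a t)
  let ?S = "{j. Suc j \<in> S}"
  have last: "length t - 1 \<in> ?S" if "t \<noteq> []"
    using Cons.prems(2) that by simp
  show ?case
  proof (cases "0 \<in> S")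
    case True
    with Cons.prems(1) have "(p @ [a]) @ nths t ?S \<in> L"
      by (simp add: nths_Cons)
    from Cons.IH[OF this last] show ?thesis by simp
  next
    case False
    \<comment> \<open>If \<open>t\<close> were empty, 0 would be the last position and so lie in
      \<open>S\<close>. Hence \<open>a\<close> is inserted before a nonempty rest.\<close>
    with Cons.prems have "p @ nths t ?S \<in> L" and "t \<noteq> []"
      by (auto simp: nths_Cons)
    with Cons.IH last show ?thesis
      using insertion_closedD[OF assms(1)] by metis
  qed
qed

text \<open>Asking for all supersets \<open>S\<close> of \<open>K\<close>, not only
  \<open>K\<close>, allows markings of several subtrees to be united. Keeping the last position
  means that undoing an erasure never inserts at the end.\<close>

definition marking :: "'a list set \<Rightarrow> 'a list \<Rightarrow> nat set \<Rightarrow> bool" where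
  "marking L t K \<longleftrightarrow>
    finite K \<and> (t \<noteq> [] \<longrightarrow> length t - 1 \<in> K) \<and> (\<forall>S. K \<subseteq> S \<longrightarrow> nths t S \<in> L)"

definition markable :: "'a list set \<Rightarrow> nat \<Rightarrow> bool" where
  "markable L n \<longleftrightarrow> (\<forall>t \<in> L. \<exists>K. marking L t K \<and> card K \<le> n)"

section \<open>Markability under the tree operators\<close>

lemma markable_conc:
  assumes "markable A m" and "markable B n"
  shows "markable (A \<cdot> B) (m + n)"
  unfolding markable_def
proof
  fix t
  assume "t \<in> A \<cdot> B"
  then obtain u v where t: "t = u @ v" "u \<in> A" "v \<in> B"
    by (auto simp: conc_def)
  obtain K where K: "marking A u K" "card K \<le> m"
    using assms(1) t(2) by (auto simp: markable_def)
  obtain K' where K': "marking B v K'" "card K' \<le> n"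
    using assms(2) t(3) by (auto simp: markable_def)
  \<comment> \<open>The marked positions of \<open>v\<close>, shifted to where \<open>v\<close> sits
    in \<open>t\<close>.\<close>
  let ?K' = "(\<lambda>j. j + length u) ` K'"
  have fin: "finite K" "finite K'" using K K' by (auto simp: marking_def)
  have "card (K \<union> ?K') \<le> m + n"
    using K(2) K'(2) card_Un_le[of K ?K'] card_image_le[OF fin(2), of "\<lambda>j. j + length u"]
    by linarith
  moreover have "length t - 1 \<in> K \<union> ?K'" if "t \<noteq> []"
  proof (cases "v = []")
    case True
    then show ?thesis using K(1) t that by (auto simp: marking_def)
  next
    case False
    then have "length t - 1 = (length v - 1) + length u" using t(1) by (cases v) auto
    then show ?thesis using K'(1) False by (auto simp: marking_def)
  qed
  moreover have "nths t S \<in> A \<cdot> B" if S: "K \<union> ?K' \<subseteq> S" for S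
  proof -
    have "nths u S \<in> A" using K(1) S by (auto simp: marking_def)
    moreover have "K' \<subseteq> {j. j + length u \<in> S}" using S by auto
    then have "nths v {j. j + length u \<in> S} \<in> B" using K'(1) by (auto simp: marking_def)
    ultimately show ?thesis unfolding conc_def t(1) nths_append by blast
  qed
  ultimately show "\<exists>K. marking (A \<cdot> B) t K \<and> card K \<le> m + n"
    using fin unfolding marking_def by (intro exI[of _ "K \<union> ?K'"]) auto
qed

lemma markable_foldr_conc:
  assumes "\<And>x. x \<in> set xs \<Longrightarrow> markable (f x) (g x)"
  shows "markable (foldr (\<cdot>) (map f xs) {[]}) (sum_list (map g xs))"
  using assms
proof (induction xs)
  case Nil
  have "marking {[]} [] {}" by (simp add: marking_def)
  then show ?case by (auto simp: markable_def intro!: exI[of _ "{}"])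
next
  case (Cons x xs)
  then show ?case by (simp add: markable_conc)
qed

text \<open>The markings of all children are united, so their sizes add up. Child \<open>i\<close>
  marks the whole trace, every other child only a prefix that belongs to its language.\<close>

lemma markable_and_lang:
  assumes "\<And>x. x \<in> set xs \<Longrightarrow> markable (f x) (g x)"
  shows "markable (and_lang (map f xs)) (sum_list (map g xs))"
  unfolding markable_def
proof
  fix t
  assume "t \<in> and_lang (map f xs)"
  then obtain i where i: "i < length xs" "t \<in> f (xs ! i)"
    and rest: "\<And>j. j < length xs \<Longrightarrow> j \<noteq> i \<Longrightarrow> t \<in> f (xs ! j) \<cdot> UNIV"
    by (auto simp: and_lang_def)
  \<comment> \<open>One formula covers both kinds of children, so that a single choice function
    \<open>K\<close> can be extracted. The full marking for \<open>j = i\<close> also supplies the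
    last position of \<open>t\<close>.\<close>
  have ex: "\<exists>K. finite K \<and> card K \<le> g (xs ! j) \<and>
      (\<forall>S. K \<subseteq> S \<longrightarrow> nths t S \<in> f (xs ! j) \<cdot> UNIV) \<and> (j = i \<longrightarrow> marking (f (xs ! i)) t K)"
    if j: "j < length xs" for j
  proof (cases "j = i")
    case True
    from assms i obtain K where K: "marking (f (xs ! i)) t K" "card K \<le> g (xs ! i)"
      unfolding markable_def by (metis nth_mem)
    have "nths t S \<in> f (xs ! i) \<cdot> UNIV" if "K \<subseteq> S" for S
    proof -
      have "nths t S \<in> f (xs ! i)" using K(1) that by (simp add: marking_def)
      moreover have "nths t S = nths t S @ []" by simp
      ultimately show ?thesis unfolding conc_def by blast
    qed
    with K True show ?thesis by (auto simp: marking_def)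
  next
    case False
    with rest[OF j] obtain u v where t: "t = u @ v" "u \<in> f (xs ! j)"
      by (auto simp: conc_def)
    from assms j t(2) obtain K where K: "marking (f (xs ! j)) u K" "card K \<le> g (xs ! j)"
      unfolding markable_def by (metis nth_mem)
    \<comment> \<open>What remains of \<open>u\<close> stays in the language of the child; what
      remains of \<open>v\<close> is absorbed by \<open>UNIV\<close>.\<close>
    have "nths t S \<in> f (xs ! j) \<cdot> UNIV" if "K \<subseteq> S" for S
      using K(1) that unfolding marking_def conc_def t(1) nths_append by blast
    with K False show ?thesis by (auto simp: marking_def)
  qed
  then obtain K where K: "\<And>j. j < length xs \<Longrightarrow> finite (K j) \<and> card (K j) \<le> g (xs ! j) \<and>
      (\<forall>S. K j \<subseteq> S \<longrightarrow> nths t S \<in> f (xs ! j) \<cdot> UNIV) \<and> (j = i \<longrightarrow> marking (f (xs ! i)) t (K j))"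
    by metis
  let ?K = "\<Union>j<length xs. K j"
  have "card ?K \<le> (\<Sum>j<length xs. card (K j))"
    by (rule card_UN_le) simp
  also have "\<dots> \<le> (\<Sum>j<length xs. g (xs ! j))"
    by (rule sum_mono) (use K in auto)
  also have "\<dots> = sum_list (map g xs)"
    by (simp add: sum_list_sum_nth atLeast0LessThan)
  finally have "card ?K \<le> sum_list (map g xs)" .
  moreover have "length t - 1 \<in> ?K" if "t \<noteq> []"
    using K[OF i(1)] i(1) that by (auto simp: marking_def)
  moreover have "nths t S \<in> and_lang (map f xs)" if S: "?K \<subseteq> S" for S
  proof -
    have "K i \<subseteq> S" using S i(1) by blast
    then have "nths t S \<in> f (xs ! i)" using K[OF i(1)] by (simp add: marking_def)
    moreover have "nths t S \<in> f (xs ! j) \<cdot> UNIV" if "j < length xs" for j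
      using K[OF that] S that by blast
    ultimately show ?thesis using i(1) by (auto simp: and_lang_def)
  qed
  moreover have "finite ?K" using K by auto
  ultimately show "\<exists>K. marking (and_lang (map f xs)) t K \<and> card K \<le> sum_list (map g xs)"
    unfolding marking_def by (intro exI[of _ ?K]) auto
qed

lemma markable_Union:
  assumes "\<And>x. x \<in> set xs \<Longrightarrow> markable (f x) (g x)"
  shows "markable (\<Union> (set (map f xs))) (sum_list (map g xs))"
  unfolding markable_def
proof
  fix t
  assume "t \<in> \<Union> (set (map f xs))"
  then obtain x where x: "x \<in> set xs" "t \<in> f x" by auto
  with assms obtain K where K: "marking (f x) t K" "card K \<le> g x"
    unfolding markable_def by metis
  have "g x \<le> sum_list (map g xs)"
    using x(1) by (intro member_le_sum_list) auto
  with K x(1) show "\<exists>K. marking (\<Union> (set (map f xs))) t K \<and> card K \<le> sum_list (map g xs)"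
    unfolding marking_def by (intro exI[of _ K]) auto
qed

text \<open>The marking for \<open>A\<close> also serves for \<open>A - B\<close>: if a shortened
  trace were in \<open>B\<close>, putting the erased letters back, all before the last one, would
  place \<open>t\<close> itself in \<open>B\<close>.\<close>

lemma markable_Diff:
  assumes "markable A n" and "insertion_closed B"
  shows "markable (A - B) n"
  unfolding markable_def
proof
  fix t
  assume t: "t \<in> A - B"
  with assms(1) obtain K where K: "marking A t K" "card K \<le> n"
    unfolding markable_def by blast
  have "nths t S \<notin> B" if "K \<subseteq> S" for S
    using insertion_closed_nths[OF assms(2), of "[]" t S] t K(1) that
    by (auto simp: marking_def)
  with K show "\<exists>K. marking (A - B) t K \<and> card K \<le> n"
    unfolding marking_def by (intro exI[of _ K]) auto
qed

lemma markable_leaf: "markable {t. t \<noteq> [] \<and> P (last t)} 1"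
  unfolding markable_def
proof
  fix t
  assume "t \<in> {t. t \<noteq> [] \<and> P (last t)}"
  then obtain u a where t: "t = u @ [a]" "P a"
    by (cases t rule: rev_cases) auto
  then have "marking {t. t \<noteq> [] \<and> P (last t)} t {length u}"
    by (auto simp: marking_def nths_append)
  then show "\<exists>K. marking {t. t \<noteq> [] \<and> P (last t)} t K \<and> card K \<le> 1"
    by (intro exI[of _ "{length u}"]) simp
qed

section \<open>Trees of countermeasure-depth at most 1\<close>

lemma markable_mono: "markable L m \<Longrightarrow> m \<le> n \<Longrightarrow> markable L n"
  unfolding markable_def by (meson order_trans)

text \<open>A leaf marks one position, so its size has to be at least 1.\<close>

lemma form_size_pos: "1 \<le> form_size \<gamma>"
  by (cases \<gamma>) auto

lemma markable_sem: "cd \<theta> \<le> 1 \<Longrightarrow> markable \<lbrakk>\<theta>\<rbrakk>\<^sub>t (adt_size \<theta>)"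
proof (induction \<theta>)
  case Eps
  have "marking {[]} [] {}" by (simp add: marking_def)
  then show ?case by (auto simp: markable_def intro!: exI[of _ "{}"])
next
  case (Leaf \<gamma>)
  show ?case using markable_mono[OF markable_leaf form_size_pos] by simp
next
  case (OR \<theta>s)
  then have "\<And>\<theta>. \<theta> \<in> set \<theta>s \<Longrightarrow> markable \<lbrakk>\<theta>\<rbrakk>\<^sub>t (adt_size \<theta>)"
    using cd_le_Max[of _ \<theta>s 1] by simp
  then show ?case using markable_Union[of \<theta>s sem adt_size] by simp
next
  case (SAND \<theta>s)
  then have "\<And>\<theta>. \<theta> \<in> set \<theta>s \<Longrightarrow> markable \<lbrakk>\<theta>\<rbrakk>\<^sub>t (adt_size \<theta>)"
    using cd_le_Max[of _ \<theta>s 1] by simp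
  then show ?case using markable_foldr_conc[of \<theta>s sem adt_size] by simp
next
  case (AND \<theta>s)
  then have "\<And>\<theta>. \<theta> \<in> set \<theta>s \<Longrightarrow> markable \<lbrakk>\<theta>\<rbrakk>\<^sub>t (adt_size \<theta>)"
    using cd_le_Max[of _ \<theta>s 1] by simp
  then show ?case using markable_and_lang[of \<theta>s sem adt_size] by simp
next
  case (Counter \<theta> \<theta>')
  \<comment> \<open>From \<open>cd \<theta>' + 1 \<le> 1\<close> the countermeasure has depth 0. The
    induction hypothesis is applied to \<open>\<theta>\<close> alone.\<close>
  then have "markable \<lbrakk>\<theta>\<rbrakk>\<^sub>t (adt_size \<theta>)" and "insertion_closed \<lbrakk>\<theta>'\<rbrakk>\<^sub>t"
    by (simp_all add: insertion_closed_sem)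
  from markable_mono[OF markable_Diff[OF this]] show ?case by simp
qed

theorem theorem1:
  fixes \<theta> :: "'p::finite adt"
  assumes "\<theta> \<in> ADT_level 1"
  shows "\<lbrakk>\<theta>\<rbrakk>\<^sub>t \<noteq> {} \<longleftrightarrow> (\<exists>t \<in> \<lbrakk>\<theta>\<rbrakk>\<^sub>t. length t \<le> adt_size \<theta>)"
proof
  assume "\<lbrakk>\<theta>\<rbrakk>\<^sub>t \<noteq> {}"
  moreover have "markable \<lbrakk>\<theta>\<rbrakk>\<^sub>t (adt_size \<theta>)"
    using assms markable_sem[of \<theta>] by (simp add: ADT_level_def)
  ultimately obtain t K where K: "marking \<lbrakk>\<theta>\<rbrakk>\<^sub>t t K" "card K \<le> adt_size \<theta>"
    unfolding markable_def by blast
  \<comment> \<open>Only an inequality, as \<open>marking\<close> does not confine \<open>K\<close>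
    to positions of \<open>t\<close>. The witness is the case \<open>S = K\<close> of the
    marking.\<close>
  have "length (nths t K) \<le> card K"
    unfolding length_nths using K(1) by (intro card_mono) (auto simp: marking_def)
  with K show "\<exists>t \<in> \<lbrakk>\<theta>\<rbrakk>\<^sub>t. length t \<le> adt_size \<theta>"
    by (intro bexI[of _ "nths t K"]) (auto simp: marking_def)
qed auto

end
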